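(* Let $n\ge3$ and let $C_n$ be a directed cycle graph with two opposite paths: with vertices labeled $v_0,v_1,\dots,v_{n-1}$ in cyclic order, there are integers $p,q\ge1$ with $p+q\le n$ such that $C_n$ has one-directional arrows $v_i\to v_{i-1}$ for $1\le i\le p$ and $v_{n-j}\to v_{n-j+1}$ for $1\le j\le q$ (where $v_n:=v_0$), and all other arrows of $C_n$ are bi-directional. Let $k$ be the number of bi-directional arrows of $C_n$ (so $k=n-p-q$). Then $\operatorname{Pic}(C_n)\cong\mathbb{Z}\times\mathbb{Z}_{k+2}$ and $\operatorname{Jac}(C_n)\cong\mathbb{Z}_{k+2}$.
   Context: A directed cycle graph on $n$ vertices has, for each cyclically consecutive pair of vertices, exactly one arrow, either one-directional or bi-directional; a bi-directional arrow between $u,w$ counts as an arrow from $u$ to $w$ and one from $w$ to $u$. The Laplacian $L_G$ of a directed graph $G$ on $n$ vertices is the $n\times n$ integer matrix with $(i,i)$ entry the number of outgoing arrows of the $i$th vertex and $(i,j)$ entry ($i\ne j$) minus the number of arrows from the $i$th to the $j$th vertex. $\operatorname{Pic}(G)=\mathbb{Z}^n/L_G^T\mathbb{Z}^n$, $\operatorname{Jac}(G)$ is its torsion subgroup, $\mathbb{Z}_m=\mathbb{Z}/m\mathbb{Z}$. *)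

theory Defs
  imports
    "Graph_Theory.Digraph"
    "Jordan_Normal_Form.Matrix"
    "HOL-Algebra.Elementary_Groups"
begin

text \<open>
  A directed graph on \<open>n\<close> vertices has vertex set \<open>{0..<n}\<close>, so that the \<open>i\<close>th row of its
  Laplacian belongs to the vertex \<open>i\<close>, and a bi-directional arrow is a pair of opposite arcs.
\<close>

definition laplacian :: "(nat, 'b) pre_digraph \<Rightarrow> int mat" where
  "laplacian G = mat (card (verts G)) (card (verts G))
     (\<lambda>(i, j). if i = j then int (out_degree G i)
               else - int (card {e \<in> arcs G. tail G e = i \<and> head G e = j}))"

definition pic :: "(nat, 'b) pre_digraph \<Rightarrow> int vec set monoid" where
  "pic G = (let n = card (verts G) in
     monoid_vec TYPE(int) n Mod (\<lambda>v. transpose_mat (laplacian G) *\<^sub>v v) ` carrier_vec n)"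

definition torsion_subgroup :: "('a, 'c) monoid_scheme \<Rightarrow> ('a, 'c) monoid_scheme" where
  "torsion_subgroup A =
     A\<lparr>carrier := {x \<in> carrier A. \<exists>m::nat. 0 < m \<and> x [^]\<^bsub>A\<^esub> m = \<one>\<^bsub>A\<^esub>}\<rparr>"

definition jac :: "(nat, 'b) pre_digraph \<Rightarrow> int vec set monoid" where
  "jac G = torsion_subgroup (pic G)"

definition one_directional :: "(nat, 'b) pre_digraph \<Rightarrow> nat \<Rightarrow> nat \<Rightarrow> bool" where
  "one_directional G u w \<longleftrightarrow> u \<rightarrow>\<^bsub>G\<^esub> w \<and> \<not> w \<rightarrow>\<^bsub>G\<^esub> u"

definition bidirectional :: "(nat, 'b) pre_digraph \<Rightarrow> nat \<Rightarrow> nat \<Rightarrow> bool" where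
  "bidirectional G u w \<longleftrightarrow> u \<rightarrow>\<^bsub>G\<^esub> w \<and> w \<rightarrow>\<^bsub>G\<^esub> u"

definition bidirectional_arrows :: "(nat, 'b) pre_digraph \<Rightarrow> nat set set" where
  "bidirectional_arrows G = {{u, w} | u w. bidirectional G u w}"

text \<open>
  In this definition \<open>n \<ge> 3\<close> is intended: only then are the \<open>n\<close> cyclically consecutive pairs
  distinct. The locale \<open>digraph\<close> excludes loops and parallel arcs.
\<close>

definition directed_cycle_graph :: "nat \<Rightarrow> (nat, 'b) pre_digraph \<Rightarrow> bool" where
  "directed_cycle_graph n G \<longleftrightarrow>
     digraph G \<and> verts G = {0..<n} \<and>
     (\<forall>u w. u \<rightarrow>\<^bsub>G\<^esub> w \<longrightarrow> w = (u + 1) mod n \<or> u = (w + 1) mod n) \<and>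
     (\<forall>u<n. let w = (u + 1) mod n in
        one_directional G u w \<or> one_directional G w u \<or> bidirectional G u w)"

definition two_opposite_paths :: "nat \<Rightarrow> nat \<Rightarrow> nat \<Rightarrow> (nat, 'b) pre_digraph \<Rightarrow> bool" where
  "two_opposite_paths n p q G \<longleftrightarrow>
     1 \<le> p \<and> 1 \<le> q \<and> p + q \<le> n \<and>
     (\<forall>i\<in>{1..p}. one_directional G i (i - 1)) \<and>
     (\<forall>j\<in>{1..q}. one_directional G (n - j) ((n - j + 1) mod n)) \<and>
     (\<forall>u w. u \<rightarrow>\<^bsub>G\<^esub> w \<and>
        (u, w) \<notin> {(i, i - 1) | i. i \<in> {1..p}} \<union> {(n - j, (n - j + 1) mod n) | j. j \<in> {1..q}}
        \<longrightarrow> bidirectional G u w)"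

lemma card_bidirectional_arrows:
  assumes n: "n \<ge> 3" and C: "directed_cycle_graph n G" and P: "two_opposite_paths n p q G"
  shows "card (bidirectional_arrows G) = n - p - q"
proof -
  interpret digraph G using C by (simp add: directed_cycle_graph_def)
  have pq: "1 \<le> p" "1 \<le> q" "p + q \<le> n" using P by (auto simp: two_opposite_paths_def)
  have vert: "u < n \<and> w < n" if "u \<rightarrow>\<^bsub>G\<^esub> w" for u w
    using that C by (auto simp: directed_cycle_graph_def arcs_ends_conv)
  let ?f = "\<lambda>x. {x, x + 1}"
  have range: "x \<in> {p..<n - q} \<and> (x + 1) mod n = x + 1"
    if b: "bidirectional G x ((x + 1) mod n)" for x
  proof -
    have xn: "x < n" using b vert by (auto simp: bidirectional_def)
    have "\<not> x < p"
    proof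
      assume "x < p"
      then have "x + 1 \<in> {1..p}" "(x + 1) mod n = x + 1" using pq by auto
      moreover from this(1) have "one_directional G (x + 1) (x + 1 - 1)"
        using P unfolding two_opposite_paths_def by blast
      ultimately show False using b by (auto simp: one_directional_def bidirectional_def)
    qed
    moreover have "\<not> n - q \<le> x"
    proof
      assume "n - q \<le> x"
      then have "n - x \<in> {1..q}" using xn by auto
      then have "one_directional G (n - (n - x)) ((n - (n - x) + 1) mod n)"
        using P unfolding two_opposite_paths_def by blast
      then show False using b xn by (auto simp: one_directional_def bidirectional_def)
    qed
    ultimately show ?thesis using pq by auto
  qed
  have "bidirectional_arrows G = ?f ` {p..<n - q}"
  proof (intro equalityI subsetI)
    fix e assume "e \<in> bidirectional_arrows G"
    then obtain u w where e: "e = {u, w}" and b: "bidirectional G u w"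
      by (auto simp: bidirectional_arrows_def)
    have b': "bidirectional G w u" using b by (auto simp: bidirectional_def)
    have "w = (u + 1) mod n \<or> u = (w + 1) mod n"
      using b C by (auto simp: bidirectional_def directed_cycle_graph_def)
    then obtain x where "e = {x, (x + 1) mod n}" "bidirectional G x ((x + 1) mod n)"
      using e b b' by (metis insert_commute)
    with range[of x] show "e \<in> ?f ` {p..<n - q}" by auto
  next
    fix e assume "e \<in> ?f ` {p..<n - q}"
    then obtain x where x: "p \<le> x" "x < n - q" "e = {x, x + 1}" by auto
    then have m: "(x + 1) mod n = x + 1" using pq by auto
    have "x < n" using x by auto
    then have "one_directional G x (x + 1) \<or> one_directional G (x + 1) x \<or> bidirectional G x (x + 1)"
      using C m unfolding directed_cycle_graph_def Let_def by metis
    then consider "x \<rightarrow>\<^bsub>G\<^esub> (x + 1)" | "(x + 1) \<rightarrow>\<^bsub>G\<^esub> x"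
      by (auto simp: one_directional_def bidirectional_def)
    then have "bidirectional G x (x + 1)"
    proof cases
      case 1
      have "(x, x + 1) \<notin> {(i, i - 1) | i. i \<in> {1..p}} \<union> {(n - j, (n - j + 1) mod n) | j. j \<in> {1..q}}"
        using x by auto
      then show ?thesis using 1 P unfolding two_opposite_paths_def by blast
    next
      case 2
      have "x \<noteq> (x + 1 + 1) mod n" using n \<open>x < n\<close> by (auto simp: mod_if)
      then have "(x + 1, x) \<notin> {(i, i - 1) | i. i \<in> {1..p}} \<union> {(n - j, (n - j + 1) mod n) | j. j \<in> {1..q}}"
        using x by auto
      then have "bidirectional G (x + 1) x" using 2 P unfolding two_opposite_paths_def by blast
      then show ?thesis by (auto simp: bidirectional_def)
    qed
    then show "e \<in> bidirectional_arrows G" using x by (auto simp: bidirectional_arrows_def)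
  qed
  moreover have "inj_on ?f {p..<n - q}" by (auto simp: inj_on_def doubleton_eq_iff)
  ultimately show ?thesis using card_image[of ?f "{p..<n - q}"] by simp
qed

end

theory Submission
  imports Defs
begin

text \<open>
  Let \<open>a = [e\<^sub>0]\<close> and \<open>d = [e\<^sub>p] - [e\<^sub>0]\<close> in the Picard group, with indices modulo \<open>n\<close>. Each interior
  vertex of the two paths has a single outgoing arc, so its class equals that of the next vertex
  and hence equals \<open>a\<close>. Each of the \<open>k + 1\<close> vertices \<open>p, \<dots>, n - q\<close> has an arc to both neighbours, so
  twice its class is the sum of theirs. The classes of \<open>p - 1, p, \<dots>, n - q + 1\<close> therefore form an
  arithmetic progression of step \<open>d\<close> that starts at \<open>a\<close> and returns to \<open>a\<close> after \<open>k + 2\<close> steps.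
  Accordingly the isomorphism is induced by \<open>v \<mapsto> (\<Sum>i. v i, \<Sum>i. c i * v i mod (k + 2))\<close>, where
  \<open>c i\<close> is the position of \<open>i\<close> in this progression, constant beyond its ends.
\<close>

section \<open>Torsion subgroups\<close>

text \<open>An injective homomorphism reflects \<open>x [^] m = \<one>\<close> as well as preserving
  it, so an isomorphism restricts to a bijection between the torsion elements.\<close>

lemma torsion_subgroup_iso:
  assumes A: "group A" and B: "group B" and iso: "A \<cong> B"
  shows "torsion_subgroup A \<cong> torsion_subgroup B"
proof -
  obtain h where h: "h \<in> hom A B" and bij: "bij_betw h (carrier A) (carrier B)"
    using iso by (auto simp: is_iso_def iso_def)
  have torsion_iff: "h x [^]\<^bsub>B\<^esub> m = \<one>\<^bsub>B\<^esub> \<longleftrightarrow> x [^]\<^bsub>A\<^esub> m = \<one>\<^bsub>A\<^esub>" if "x \<in> carrier A" for x and m :: nat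
  proof -
    have "h (x [^]\<^bsub>A\<^esub> m) = h x [^]\<^bsub>B\<^esub> m" by (rule hom_nat_pow[OF h that A B])
    moreover have "h \<one>\<^bsub>A\<^esub> = \<one>\<^bsub>B\<^esub>" by (rule hom_one[OF h A B])
    moreover have "x [^]\<^bsub>A\<^esub> m \<in> carrier A" "\<one>\<^bsub>A\<^esub> \<in> carrier A"
      using A that by (simp_all add: group.is_monoid monoid.nat_pow_closed)
    ultimately show ?thesis using bij by (metis bij_betw_imp_inj_on inj_on_eq_iff)
  qed
  have "bij_betw h (carrier (torsion_subgroup A)) (carrier (torsion_subgroup B))"
  proof (rule bij_betw_subset[OF bij])
    show "carrier (torsion_subgroup A) \<subseteq> carrier A" by (auto simp: torsion_subgroup_def)
    have "carrier B = h ` carrier A" using bij by (simp add: bij_betw_def)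
    then show "h ` carrier (torsion_subgroup A) = carrier (torsion_subgroup B)"
      by (force simp: torsion_subgroup_def torsion_iff)
  qed
  moreover from this have "h \<in> hom (torsion_subgroup A) (torsion_subgroup B)"
    using h by (intro homI) (auto simp: torsion_subgroup_def hom_mult dest: bij_betwE)
  ultimately show ?thesis by (auto simp: is_iso_def iso_def)
qed

lemma nat_pow_DirProd:
  "(x, y) [^]\<^bsub>G \<times>\<times> H\<^esub> (m::nat) = (x [^]\<^bsub>G\<^esub> m, y [^]\<^bsub>H\<^esub> m)"
  by (induction m) simp_all

text \<open>No nonzero integer has a positive multiple equal to 0, while \<open>m\<close>
  annihilates all of the finite factor. The torsion elements are thus the pairs with first component
  0, and \<open>snd\<close> is the isomorphism.\<close>

lemma torsion_subgroup_integer_times_integer_mod: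
  assumes "m > 0"
  shows "torsion_subgroup (integer_group \<times>\<times> integer_mod_group m) \<cong> integer_mod_group m"
proof -
  have carr: "carrier (torsion_subgroup (integer_group \<times>\<times> integer_mod_group m))
      = {0} \<times> carrier (integer_mod_group m)"
    using assms by (auto simp: torsion_subgroup_def nat_pow_DirProd intro!: exI[of _ m])
  have "snd \<in> hom (torsion_subgroup (integer_group \<times>\<times> integer_mod_group m)) (integer_mod_group m)"
    by (rule homI) (auto simp: carr, auto simp: torsion_subgroup_def mult_DirProd')
  moreover have "bij_betw snd ({0::int} \<times> carrier (integer_mod_group m)) (carrier (integer_mod_group m))"
    by (rule bij_betwI[where g = "Pair 0"]) auto
  ultimately show ?thesis unfolding is_iso_def iso_def carr[symmetric] by blast
qed

section \<open>The Laplacian of a directed cycle graph with two opposite paths\<close>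

context digraph
begin

text \<open>Parallel arcs are excluded, so the arc counts in the Laplacian are indicators of
  adjacency.\<close>

lemma card_arcs_between: "card {e \<in> arcs G. tail G e = i \<and> head G e = j} = of_bool (i \<rightarrow> j)"
proof (cases "i \<rightarrow> j")
  case True
  then obtain e where e: "e \<in> arcs G" "tail G e = i" "head G e = j"
    by (auto simp: arcs_ends_conv)
  then have "{e \<in> arcs G. tail G e = i \<and> head G e = j} = {e}"
    by (auto intro!: no_multi_arcs simp: arc_to_ends_def)
  with True show ?thesis by simp
next
  case False
  then have "{e \<in> arcs G. tail G e = i \<and> head G e = j} = {}"
    by (auto simp: arcs_ends_conv)
  with False show ?thesis by simp
qed

lemma out_degree_eq_sum: "out_degree G i = (\<Sum>j\<in>verts G. of_bool (i \<rightarrow> j))"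
proof -
  have "out_arcs G i = (\<Union>j\<in>verts G. {e \<in> arcs G. tail G e = i \<and> head G e = j})"
    by (auto simp: out_arcs_def)
  then have "out_degree G i = (\<Sum>j\<in>verts G. card {e \<in> arcs G. tail G e = i \<and> head G e = j})"
    unfolding out_degree_def by (simp only:) (rule card_UN_disjoint', auto simp: disjoint_family_on_def)
  then show ?thesis by (simp only: card_arcs_between)
qed

end

text \<open>Writing the out-degree as a sum of indicators turns the Laplacian into a difference
  operator along outgoing arcs.\<close>

lemma laplacian_apply:
  fixes f :: "nat \<Rightarrow> int"
  assumes G: "digraph G" and V: "verts G = {0..<n}" and i: "i < n"
  shows "(\<Sum>j<n. laplacian G $$ (i, j) * f j) = (\<Sum>j<n. of_bool (i \<rightarrow>\<^bsub>G\<^esub> j) * (f i - f j))"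
proof -
  interpret digraph G by (rule G)
  \<comment> \<open>As there are no loops, the indicator vanishes at \<open>j = i\<close>, so one
    formula covers diagonal and off-diagonal entries.\<close>
  have entry: "laplacian G $$ (i, j) * f j
      = (if j = i then int (out_degree G i) * f j else 0) - of_bool (i \<rightarrow>\<^bsub>G\<^esub> j) * f j" if "j < n" for j
    using i that V adj_not_same
    by (auto simp: laplacian_def card_arcs_between)
  have "(\<Sum>j<n. laplacian G $$ (i, j) * f j)
      = (\<Sum>j<n. if j = i then int (out_degree G i) * f j else 0) - (\<Sum>j<n. of_bool (i \<rightarrow>\<^bsub>G\<^esub> j) * f j)"
    by (simp add: entry sum_subtractf)
  also have "(\<Sum>j<n. if j = i then int (out_degree G i) * f j else 0) = int (out_degree G i) * f i"
    using i by simp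
  also have "\<dots> = (\<Sum>j<n. of_bool (i \<rightarrow>\<^bsub>G\<^esub> j) * f i)"
    by (simp add: out_degree_eq_sum V sum_distrib_right lessThan_atLeast0)
  finally show ?thesis by (simp add: sum_subtractf right_diff_distrib)
qed

text \<open>The pair of \<open>x\<close> and its cyclic successor lies on the first path for
  \<open>x < p\<close>, on the second for \<open>n - q \<le> x\<close>, and is bi-directional in
  between. Hence its forward arc exists iff \<open>p \<le> x\<close> and its backward arc iff
  \<open>x < n - q\<close>.\<close>

lemma two_opposite_paths_adj:
  assumes n: "n \<ge> 3" and C: "directed_cycle_graph n G" and P: "two_opposite_paths n p q G"
  shows "i \<rightarrow>\<^bsub>G\<^esub> j \<longleftrightarrow>
    i < n \<and> (1 \<le> i \<and> i \<le> n - q \<and> j = i - 1 \<or> p \<le> i \<and> j = (i + 1) mod n)"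
proof -
  interpret digraph G using C by (simp add: directed_cycle_graph_def)
  have pq: "1 \<le> p" "1 \<le> q" "p + q \<le> n" using P by (auto simp: two_opposite_paths_def)
  have vert: "u < n \<and> w < n" if "u \<rightarrow>\<^bsub>G\<^esub> w" for u w
    using that C by (auto simp: directed_cycle_graph_def arcs_ends_conv)
  have succ: "x \<rightarrow>\<^bsub>G\<^esub> ((x + 1) mod n) \<longleftrightarrow> p \<le> x" and pred: "((x + 1) mod n) \<rightarrow>\<^bsub>G\<^esub> x \<longleftrightarrow> x < n - q"
    if x: "x < n" for x
  proof -
    let ?y = "(x + 1) mod n"
    have path_p: "one_directional G ?y x" if "x < p"
    proof -
      have "x + 1 \<in> {1..p}" using that by auto
      then have "one_directional G (x + 1) (x + 1 - 1)"
        using P unfolding two_opposite_paths_def by blast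
      with that pq show ?thesis by simp
    qed
    have path_q: "one_directional G x ?y" if "n - q \<le> x"
    proof -
      have "n - x \<in> {1..q}" using that x by auto
      then have "one_directional G (n - (n - x)) ((n - (n - x) + 1) mod n)"
        using P unfolding two_opposite_paths_def by blast
      with x show ?thesis by simp
    qed
    have mid: "bidirectional G x ?y" if "p \<le> x" "x < n - q"
    proof -
      have y: "?y = x + 1" using that pq by simp
      \<comment> \<open>Two steps along a cycle of length at least 3 do not return to the start, so
        the reversed pair is not an arc of the second path.\<close>
      have "x \<noteq> (x + 1 + 1) mod n" using n x by (auto simp: mod_if)
      then have out:
        "(x, ?y) \<notin> {(i, i - 1) | i. i \<in> {1..p}} \<union> {(n - j, (n - j + 1) mod n) | j. j \<in> {1..q}}"
        "(?y, x) \<notin> {(i, i - 1) | i. i \<in> {1..p}} \<union> {(n - j, (n - j + 1) mod n) | j. j \<in> {1..q}}"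
        using that unfolding y by auto
      have "x \<rightarrow>\<^bsub>G\<^esub> ?y \<or> ?y \<rightarrow>\<^bsub>G\<^esub> x"
        using C x unfolding directed_cycle_graph_def Let_def one_directional_def bidirectional_def
        by blast
      then have "bidirectional G x ?y \<or> bidirectional G ?y x"
        using P out unfolding two_opposite_paths_def by blast
      then show ?thesis by (auto simp: bidirectional_def)
    qed
    show "x \<rightarrow>\<^bsub>G\<^esub> ?y \<longleftrightarrow> p \<le> x" "?y \<rightarrow>\<^bsub>G\<^esub> x \<longleftrightarrow> x < n - q"
      using path_p path_q mid pq unfolding one_directional_def bidirectional_def
      by (metis add_le_imp_le_diff le_trans linorder_not_le)+
  qed
  show ?thesis
  proof
    assume ij: "i \<rightarrow>\<^bsub>G\<^esub> j"
    then have lt: "i < n" "j < n" using vert by blast+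
    have "j = (i + 1) mod n \<or> i = (j + 1) mod n"
      using ij C by (auto simp: directed_cycle_graph_def)
    then show "i < n \<and> (1 \<le> i \<and> i \<le> n - q \<and> j = i - 1 \<or> p \<le> i \<and> j = (i + 1) mod n)"
    proof
      assume "j = (i + 1) mod n"
      then show ?thesis using succ[of i] ij lt by auto
    next
      assume i: "i = (j + 1) mod n"
      then have "j < n - q" using pred[of j] ij lt by auto
      then show ?thesis using i lt pq by auto
    qed
  next
    assume *: "i < n \<and> (1 \<le> i \<and> i \<le> n - q \<and> j = i - 1 \<or> p \<le> i \<and> j = (i + 1) mod n)"
    then consider "1 \<le> i" "i \<le> n - q" "j = i - 1" | "p \<le> i" "j = (i + 1) mod n" by blast
    then show "i \<rightarrow>\<^bsub>G\<^esub> j"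
    proof cases
      case 1
      then have "(j + 1) mod n = i" "j < n" "j < n - q" using * by auto
      then show ?thesis using pred[of j] by simp
    next
      case 2
      then show ?thesis using succ[of i] * by simp
    qed
  qed
qed

lemma two_opposite_paths_laplacian_apply:
  fixes f :: "nat \<Rightarrow> int"
  assumes n: "n \<ge> 3" and C: "directed_cycle_graph n G" and P: "two_opposite_paths n p q G"
    and i: "i < n"
  shows "(\<Sum>j<n. laplacian G $$ (i, j) * f j)
    = of_bool (1 \<le> i \<and> i \<le> n - q) * (f i - f (i - 1)) + of_bool (p \<le> i) * (f i - f ((i + 1) mod n))"
proof -
  have G: "digraph G" "verts G = {0..<n}" using C by (auto simp: directed_cycle_graph_def)
  \<comment> \<open>The two possible out-neighbours differ, so the adjacency indicator splits into a
    sum of two. At \<open>i = 0\<close> the truncated \<open>i - 1\<close> is harmless, its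
    coefficient being 0.\<close>
  have ne: "i - 1 \<noteq> (i + 1) mod n" if "1 \<le> i" using n i that by (auto simp: mod_if)
  have split: "of_bool (i \<rightarrow>\<^bsub>G\<^esub> j) * (f i - f j)
      = (if j = i - 1 then of_bool (1 \<le> i \<and> i \<le> n - q) * (f i - f j) else 0)
      + (if j = (i + 1) mod n then of_bool (p \<le> i) * (f i - f j) else 0)" for j
    unfolding two_opposite_paths_adj[OF n C P] using i ne by auto
  show ?thesis
    unfolding laplacian_apply[OF G i] split sum.distrib using i n by simp
qed

section \<open>The Picard group\<close>

text \<open>Truncated subtraction makes \<open>c\<close> vanish below \<open>p\<close>, and the
  minimum holds it at \<open>m\<close> from \<open>n - q + 1\<close> on; in between it rises by 1
  per step. One inclusion evaluates the Laplacian on the functions 1 and \<open>c\<close>; the other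
  reduces every unit vector modulo the image.\<close>

lemma kernel_eq_image_laplacian:
  assumes n: "n \<ge> 3" and C: "directed_cycle_graph n G" and P: "two_opposite_paths n p q G"
  defines "m \<equiv> n - p - q + 2"
  defines "c \<equiv> \<lambda>i. int (min (i + 1 - p) m)"
  shows "{v \<in> carrier_vec n. (\<Sum>i<n. v $ i) = 0 \<and> int m dvd (\<Sum>i<n. c i * v $ i)}
    = (\<lambda>v. transpose_mat (laplacian G) *\<^sub>v v) ` carrier_vec n"
    (is "?K = ?I")
proof -
  note apply_L = two_opposite_paths_laplacian_apply[OF n C P]
  have pq: "1 \<le> p" "1 \<le> q" "p + q \<le> n" using P by (auto simp: two_opposite_paths_def)
  have dim: "laplacian G \<in> carrier_mat n n"
    using C by (simp add: laplacian_def directed_cycle_graph_def)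
  have entry: "(transpose_mat (laplacian G) *\<^sub>v w) $ j = (\<Sum>i<n. w $ i * laplacian G $$ (i, j))"
    if "w \<in> carrier_vec n" "j < n" for w j
    using that dim by (simp add: scalar_prod_def lessThan_atLeast0 mult.commute)
  have c0: "c 0 = 0" and cn: "c n = int m" and cp: "c p = 1"
    using pq by (auto simp: c_def m_def)
  show ?thesis
  proof (intro equalityI subsetI)
    fix v assume "v \<in> ?I"
    then obtain w where w: "w \<in> carrier_vec n" and v: "v = transpose_mat (laplacian G) *\<^sub>v w" by blast
    \<comment> \<open>Adjointness: pairing \<open>f\<close> with the image of \<open>w\<close> under
      the transpose is pairing \<open>w\<close> with the Laplacian of \<open>f\<close>.\<close>
    have pairing: "(\<Sum>j<n. f j * v $ j) = (\<Sum>i<n. w $ i * (\<Sum>j<n. laplacian G $$ (i, j) * f j))" for f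
    proof -
      have "(\<Sum>j<n. f j * v $ j) = (\<Sum>j<n. \<Sum>i<n. w $ i * (laplacian G $$ (i, j) * f j))"
        unfolding v by (intro sum.cong) (auto simp: entry[OF w] sum_distrib_left mult_ac)
      also have "\<dots> = (\<Sum>i<n. \<Sum>j<n. w $ i * (laplacian G $$ (i, j) * f j))" by (rule sum.swap)
      finally show ?thesis by (simp add: sum_distrib_left)
    qed
    have "(\<Sum>j<n. v $ j) = 0" using pairing[of "\<lambda>_. 1"] apply_L[of _ "\<lambda>_. 1"] by simp
    moreover have "int m dvd (\<Sum>j<n. c j * v $ j)"
      unfolding pairing
    proof (rule dvd_sum[OF dvd_mult])
      fix i assume "i \<in> {..<n}"
      then have i: "i < n" by simp
      \<comment> \<open>Going once around the cycle, \<open>c\<close> jumps from \<open>m\<close>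
        back to 0. Without this jump both differences below would cancel: they are 1 and -1 for
        \<open>p \<le> i \<le> n - q\<close>, and otherwise each has difference 0 or coefficient
        0.\<close>
      have "c ((i + 1) mod n) = c (i + 1) - of_bool (i + 1 = n) * int m"
        using i c0 cn by (cases "i + 1 = n") auto
      moreover have "of_bool (1 \<le> i \<and> i \<le> n - q) * (c i - c (i - 1)) + of_bool (p \<le> i) * (c i - c (i + 1)) = 0"
        using i pq by (auto simp: c_def m_def)
      ultimately have "(\<Sum>j<n. laplacian G $$ (i, j) * c j)
          = of_bool (p \<le> i) * of_bool (i + 1 = n) * int m"
        unfolding apply_L[OF i] by (simp add: algebra_simps)
      then show "int m dvd (\<Sum>j<n. laplacian G $$ (i, j) * c j)" by simp
    qed
    moreover have "v \<in> carrier_vec n" using v w dim by auto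
    ultimately show "v \<in> ?K" by simp
  next
    \<comment> \<open>\<open>im f\<close> says that \<open>f\<close>, restricted to the indices
      below \<open>n\<close>, is an integer combination of rows of the Laplacian, that is, lies in
      the image of its transpose.\<close>
    define im :: "(nat \<Rightarrow> int) \<Rightarrow> bool"
      where "im f \<longleftrightarrow> (\<exists>w. \<forall>j<n. f j = (\<Sum>i<n. w i * laplacian G $$ (i, j)))" for f
    have im_0: "im (\<lambda>_. 0)" unfolding im_def by (rule exI[of _ "\<lambda>_. 0"]) simp
    have im_cong: "im f \<Longrightarrow> (\<And>j. j < n \<Longrightarrow> f j = g j) \<Longrightarrow> im g" for f g
      unfolding im_def by metis
    have im_lin: "im (\<lambda>j. x * f j + y * g j)" if "im f" "im g" for f g x y
    proof -
      obtain w u where "\<forall>j<n. f j = (\<Sum>i<n. w i * laplacian G $$ (i, j))"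
        and "\<forall>j<n. g j = (\<Sum>i<n. u i * laplacian G $$ (i, j))"
        using \<open>im f\<close> \<open>im g\<close> unfolding im_def by blast
      then show ?thesis unfolding im_def
        by (intro exI[of _ "\<lambda>i. x * w i + y * u i"])
          (simp add: sum.distrib sum_distrib_left algebra_simps)
    qed
    have im_sum: "im (\<lambda>j. \<Sum>i\<in>S. x i * f i j)" if "finite S" "\<And>i. i \<in> S \<Longrightarrow> im (f i)" for S x f
      using that
    proof (induction S)
      case empty
      then show ?case using im_0 by simp
    next
      case (insert a S)
      then show ?case using im_lin[of "f a" "\<lambda>j. \<Sum>i\<in>S. x i * f i j" "x a" 1] by simp
    qed
    \<comment> \<open>Unit vectors with the index read modulo \<open>n\<close>, so that
      \<open>e n = e 0\<close> and the successor of the last vertex needs no separate case.\<close>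
    define e :: "nat \<Rightarrow> nat \<Rightarrow> int" where "e i j = of_bool (j = i mod n)" for i j
    have im_row: "im (\<lambda>j. of_bool (1 \<le> i \<and> i \<le> n - q) * (e i j - e (i - 1) j)
        + of_bool (p \<le> i) * (e i j - e (i + 1) j))" if i: "i < n" for i
    proof -
      have "im (\<lambda>j. laplacian G $$ (i, j))"
        unfolding im_def
        by (rule exI[of _ "\<lambda>l. of_bool (l = i)"])
          (use i in \<open>simp add: of_bool_def if_distribR if_distrib[where f = "(*)"] cong: if_cong\<close>)
      then show ?thesis
      proof (rule im_cong)
        fix j assume j: "j < n"
        have "laplacian G $$ (i, j) = (\<Sum>l<n. laplacian G $$ (i, l) * of_bool (l = j))"
          using j by (simp add: of_bool_def if_distrib[where f = "(*) _"] cong: if_cong)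
        \<comment> \<open>The row is read off by applying the difference formula to the indicator
          function of \<open>j\<close>.\<close>
        also have "\<dots> = of_bool (1 \<le> i \<and> i \<le> n - q) * (e i j - e (i - 1) j)
            + of_bool (p \<le> i) * (e i j - e (i + 1) j)"
          unfolding apply_L[OF i] using i by (simp add: e_def eq_commute[of j])
        finally show "laplacian G $$ (i, j) = \<dots>" .
      qed
    qed
    \<comment> \<open>In the quotient this reads \<open>[e i] = a + c i * d\<close>. The case
      \<open>i = n\<close> is included because \<open>e n = e 0\<close> and \<open>c n = m\<close>
      turn it into \<open>m * d = 0\<close>.\<close>
    have im_vertex: "im (\<lambda>j. e i j - e 0 j - c i * (e p j - e 0 j))" if "i \<le> n" for i
      using that
    proof (induction i rule: less_induct)
      case (less i)
      consider "i = 0" | "1 \<le> i" "i < p" | "i = p" | "p < i" "i \<le> n - q + 1" | "n - q + 1 < i"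
        using pq by linarith
      then show ?case
      proof cases
        case 1
        then show ?thesis using im_0 c0 by simp
      next
        case 2
        \<comment> \<open>The row of \<open>i\<close> itself, which has only its backward arc,
          identifies \<open>e i\<close> with \<open>e (i - 1)\<close>.\<close>
        then have "im (\<lambda>j. 1 * (e (i - 1) j - e 0 j - c (i - 1) * (e p j - e 0 j))
            + 1 * (of_bool (1 \<le> i \<and> i \<le> n - q) * (e i j - e (i - 1) j)
              + of_bool (p \<le> i) * (e i j - e (i + 1) j)))"
          using less.prems pq by (intro im_lin im_row less.IH) auto
        moreover have "i \<le> n - q" using 2 pq by linarith
        ultimately show ?thesis using 2 by (simp add: c_def)
      next
        case 3
        then show ?thesis using im_0 cp by simp
      next
        case 4
        \<comment> \<open>The row used is that of \<open>l + 1 = i - 1\<close>, a vertex with arcs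
          to both neighbours, and it expresses \<open>e i\<close> through its two predecessors. The
          recurrence \<open>c_step\<close> holds at both ends of the range:
          \<open>c (p - 1) = 0\<close> and \<open>c (n - q + 1) = m\<close>.\<close>
        define l where "l = i - 2"
        have i: "i = l + 2" "l + 1 < n" "p \<le> l + 1" "l + 1 \<le> n - q"
          using 4 pq less.prems by (auto simp: l_def)
        have c_step: "c (Suc (Suc l)) = 2 * c (Suc l) - c l"
          using i pq by (auto simp: c_def m_def)
        have "im (\<lambda>j. 1 * (2 * (e (l + 1) j - e 0 j - c (l + 1) * (e p j - e 0 j))
            + (- 1) * (e l j - e 0 j - c l * (e p j - e 0 j)))
            + (- 1) * (of_bool (1 \<le> l + 1 \<and> l + 1 \<le> n - q) * (e (l + 1) j - e (l + 1 - 1) j)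
              + of_bool (p \<le> l + 1) * (e (l + 1) j - e (l + 1 + 1) j)))"
          using i by (intro im_lin im_row less.IH) auto
        then show ?thesis
          using i by (elim im_cong) (simp add: c_step algebra_simps)
      next
        case 5
        \<comment> \<open>The row of \<open>l = i - 1\<close>, which has only its forward arc,
          identifies \<open>e i\<close> with \<open>e l\<close>.\<close>
        define l where "l = i - 1"
        have i: "i = l + 1" "l < n" "p \<le> l" "n - q < l"
          using 5 pq less.prems by (auto simp: l_def)
        have "im (\<lambda>j. 1 * (e l j - e 0 j - c l * (e p j - e 0 j))
            + (- 1) * (of_bool (1 \<le> l \<and> l \<le> n - q) * (e l j - e (l - 1) j)
              + of_bool (p \<le> l) * (e l j - e (l + 1) j)))"
          using i by (intro im_lin im_row less.IH) auto
        moreover have "c i = c l" using i pq by (auto simp: c_def m_def)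
        ultimately show ?thesis
          using i by (elim im_cong) (simp add: algebra_simps)
      qed
    qed
    fix v assume "v \<in> ?K"
    then have v: "v \<in> carrier_vec n" and sum0: "(\<Sum>i<n. v $ i) = 0"
      and "int m dvd (\<Sum>i<n. c i * v $ i)" by auto
    then obtain t where t: "(\<Sum>i<n. c i * v $ i) = int m * t" by (elim dvdE)
    \<comment> \<open>By the two conditions on \<open>v\<close> the sum equals
      \<open>v - m * t * (e p - e 0)\<close>. The relation at \<open>n\<close> is
      \<open>- m * (e p - e 0)\<close>, so adding it \<open>- t\<close> times leaves
      \<open>v\<close>.\<close>
    have "im (\<lambda>j. 1 * (\<Sum>i<n. v $ i * (e i j - e 0 j - c i * (e p j - e 0 j)))
        + (- t) * (e n j - e 0 j - c n * (e p j - e 0 j)))"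
      by (intro im_lin im_sum im_vertex) auto
    then have "im (\<lambda>j. v $ j)"
    proof (rule im_cong)
      fix j assume j: "j < n"
      have "(\<Sum>i<n. v $ i * (e i j - e 0 j - c i * (e p j - e 0 j)))
          = (\<Sum>i<n. v $ i * e i j) - (\<Sum>i<n. v $ i) * e 0 j - (\<Sum>i<n. c i * v $ i) * (e p j - e 0 j)"
        by (simp add: sum_subtractf sum.distrib sum_distrib_left sum_distrib_right algebra_simps)
      also have "(\<Sum>i<n. v $ i * e i j) = (\<Sum>i<n. if j = i then v $ i else 0)"
        by (intro sum.cong) (auto simp: e_def)
      also have "\<dots> = v $ j" using j by (simp add: sum.delta')
      finally show "1 * (\<Sum>i<n. v $ i * (e i j - e 0 j - c i * (e p j - e 0 j)))
          + (- t) * (e n j - e 0 j - c n * (e p j - e 0 j)) = v $ j"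
        by (simp add: sum0 t cn e_def)
    qed
    then obtain w where w: "\<forall>j<n. v $ j = (\<Sum>i<n. w i * laplacian G $$ (i, j))"
      unfolding im_def by blast
    have "v = transpose_mat (laplacian G) *\<^sub>v vec n w"
    proof (rule eq_vecI)
      show "dim_vec v = dim_vec (transpose_mat (laplacian G) *\<^sub>v vec n w)" using v dim by auto
      fix j assume "j < dim_vec (transpose_mat (laplacian G) *\<^sub>v vec n w)"
      then have "j < n" using dim by auto
      then show "v $ j = (transpose_mat (laplacian G) *\<^sub>v vec n w) $ j"
        using w by (subst entry) auto
    qed
    then show "v \<in> ?I" by auto
  qed
qed

text \<open>The first isomorphism theorem for the surjection \<open>h\<close>. That
  \<open>pic G\<close> is a group is recorded for the passage to torsion subgroups.\<close>

lemma pic_two_opposite_paths: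
  assumes n: "n \<ge> 3" and C: "directed_cycle_graph n G" and P: "two_opposite_paths n p q G"
  defines "m \<equiv> n - p - q + 2"
  shows "group (pic G)" and "pic G \<cong> integer_group \<times>\<times> integer_mod_group m"
proof -
  let ?V = "monoid_vec TYPE(int) n" and ?H = "integer_group \<times>\<times> integer_mod_group m"
  define c where "c i = int (min (i + 1 - p) m)" for i
  define h where "h v = (\<Sum>i<n. v $ i, (\<Sum>i<n. c i * v $ i) mod int m)" for v :: "int vec"
  have pq: "1 \<le> p" "1 \<le> q" "p + q \<le> n" using P by (auto simp: two_opposite_paths_def)
  have m: "m > 0" by (simp add: m_def)
  have "group ?V" using comm_group_vec by (rule comm_group.axioms(2))
  moreover have "group ?H" by (intro DirProd_group) auto
  moreover have "h \<in> hom ?V ?H"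
  proof (rule homI)
    show "h v \<in> carrier ?H" for v using m by (simp add: h_def carrier_integer_mod_group)
    fix v w assume "v \<in> carrier ?V" "w \<in> carrier ?V"
    then show "h (v \<otimes>\<^bsub>?V\<^esub> w) = h v \<otimes>\<^bsub>?H\<^esub> h w"
      by (simp add: monoid_vec_simps h_def sum.distrib distrib_left mod_add_eq)
  qed
  ultimately interpret group_hom ?V ?H h by (simp add: group_hom_def group_hom_axioms_def)
  have "h ` carrier ?V = carrier ?H"
  proof (rule equalityI)
    show "h ` carrier ?V \<subseteq> carrier ?H" using hom_closed by blast
    show "carrier ?H \<subseteq> h ` carrier ?V"
    proof
      fix z assume "z \<in> carrier ?H"
      then obtain a b where z: "z = (a, b)" "0 \<le> b" "b < int m"
        using m by (auto simp: carrier_integer_mod_group)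
      \<comment> \<open>The preimage is \<open>(a - b) * e 0 + b * e p\<close>: its coordinates sum
        to \<open>a\<close>, and \<open>c 0 = 0\<close>, \<open>c p = 1\<close> make the weighted
        sum \<open>b\<close>.\<close>
      define v where "v = vec n (\<lambda>i. if i = 0 then a - b else if i = p then b else 0)"
      have vi: "x i * v $ i = (if i = 0 then x i * (a - b) else 0) + (if i = p then x i * b else 0)"
        if "i < n" for i and x :: "nat \<Rightarrow> int"
        using that pq by (auto simp: v_def)
      have sum_v: "(\<Sum>i<n. x i * v $ i) = x 0 * (a - b) + x p * b" for x :: "nat \<Rightarrow> int"
        using pq by (simp add: vi sum.distrib)
      have "(\<Sum>i<n. v $ i) = a" using sum_v[of "\<lambda>_. 1"] by simp
      moreover have "(\<Sum>i<n. c i * v $ i) = c 0 * (a - b) + c p * b"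
        by (rule sum_v)
      moreover have "c 0 = 0" "c p = 1" using pq by (auto simp: c_def m_def)
      ultimately have "h v = z" using z by (simp add: h_def)
      moreover have "v \<in> carrier ?V" by (simp add: v_def monoid_vec_simps)
      ultimately show "z \<in> h ` carrier ?V" by blast
    qed
  qed
  moreover have "kernel ?V ?H h = (\<lambda>v. transpose_mat (laplacian G) *\<^sub>v v) ` carrier_vec n"
    unfolding kernel_eq_image_laplacian[OF n C P, folded m_def, symmetric]
    by (auto simp: kernel_def h_def c_def monoid_vec_simps dvd_eq_mod_eq_0)
  then have pic: "pic G = ?V Mod kernel ?V ?H h"
    using C by (simp add: pic_def directed_cycle_graph_def)
  ultimately show "pic G \<cong> ?H" using FactGroup_iso by simp
  show "group (pic G)" unfolding pic by (rule normal.factorgroup_is_group[OF normal_kernel])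
qed

theorem theorem4p12:
  fixes G :: "(nat, 'b) pre_digraph" and n p q k :: nat
  assumes "n \<ge> 3"
    and "directed_cycle_graph n G"
    and "two_opposite_paths n p q G"
    and "k = card (bidirectional_arrows G)"
  shows "pic G \<cong> integer_group \<times>\<times> integer_mod_group (k + 2) \<and>
         jac G \<cong> integer_mod_group (k + 2)"
proof -
  have k: "k = n - p - q" using assms card_bidirectional_arrows by blast
  note pic = pic_two_opposite_paths[OF assms(1-3), folded k]
  have "jac G \<cong> torsion_subgroup (integer_group \<times>\<times> integer_mod_group (k + 2))"
    unfolding jac_def by (intro torsion_subgroup_iso pic DirProd_group) auto
  also have "\<dots> \<cong> integer_mod_group (k + 2)"
    by (rule torsion_subgroup_integer_times_integer_mod) simp
  finally show ?thesis using pic by blast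
qed

end
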